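(* (I) For all $n\ge1$ and $k=1,\dots,L_{2n-1}$, the canonical representation $\gamma(L_{2n}+k)$ is obtained by adding, digitwise (aligned at the point), the digits of $\gamma(k)$ to those of $10^{2n}\cdot0^{2n-1}1$; i.e. $\gamma(L_{2n}+k)=10\dots0\,\gamma(k)\,0\dots01$. (II) For all $n\ge2$ and $k=1,\dots,L_{2n-2}$: \[\gamma(L_{2n+1}+k)=1000(10)^{-1}\gamma(L_{2n-1}+k)(01)^{-1}1001,\] \[\gamma(L_{2n+1}+L_{2n-1}+k)=1010(10)^{-1}\gamma(L_{2n-1}+k)(01)^{-1}0001.\] Moreover, for all $n\ge2$ and $k=1,\dots,L_{2n-3}$: \[\gamma(L_{2n+1}+L_{2n-2}+k)=10010(10)^{-1}\gamma(L_{2n-2}+k)(01)^{-1}001001.\]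
   Context: Let $\varphi=(1+\sqrt5)/2$. Lucas numbers: $L_0=2$, $L_1=1$, $L_n=L_{n-1}+L_{n-2}$. A base-$\varphi$ representation $N=\sum_{i=R}^{L}a_i\varphi^i$ is written as the string $a_L\dots a_0\cdot a_{-1}\dots a_R$ (point between indices $0$ and $-1$); $0^k$ denotes $k$ zeros. The Bergman representation $\beta(N)$ is the unique finite expansion of $N$ with digits in $\{0,1\}$ and no two consecutive digits $11$. The canonical representation $\gamma(N)$: if $N$ has a finite representation with digits in $\{0,1\}$, $c_1=c_0=1$, and $c_{i+1}c_i\ne11$ for all $i\ne0$, then $\gamma(N)$ is this (unique) representation; otherwise $\gamma(N)=\beta(N)$. Free-group notation for words: $p\,u^{-1}w$ means the word $w$ begins with $u$, which is removed and replaced by the prefix $p$; $w\,v^{-1}s$ means $w$ ends with $v$, which is removed and replaced by the suffix $s$. The point of the middle word $\gamma(\cdot)$ keeps its position, so it is the point of the resulting word. *)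

theory Defs
  imports Complex_Main
begin

definition golden :: real where
  "golden = (1 + sqrt 5) / 2"

fun lucas :: "nat \<Rightarrow> nat" where
  "lucas 0 = 2"
| "lucas (Suc 0) = 1"
| "lucas (Suc (Suc n)) = lucas (Suc n) + lucas n"

definition binary_rep :: "nat \<Rightarrow> (int \<Rightarrow> nat) \<Rightarrow> bool" where
  "binary_rep N d \<longleftrightarrow>
     finite {i. d i \<noteq> 0} \<and> (\<forall>i. d i \<in> {0, 1}) \<and>
     real N = (\<Sum>i\<in>{i. d i \<noteq> 0}. real (d i) * golden powi i)"

definition bergman_rep :: "nat \<Rightarrow> (int \<Rightarrow> nat) \<Rightarrow> bool" where
  "bergman_rep N d \<longleftrightarrow> binary_rep N d \<and> (\<forall>i. \<not> (d (i + 1) = 1 \<and> d i = 1))"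

definition beta :: "nat \<Rightarrow> int \<Rightarrow> nat" where
  "beta N = (THE d. bergman_rep N d)"

definition one_one_rep :: "nat \<Rightarrow> (int \<Rightarrow> nat) \<Rightarrow> bool" where
  "one_one_rep N c \<longleftrightarrow> binary_rep N c \<and> c 1 = 1 \<and> c 0 = 1 \<and>
     (\<forall>i. i \<noteq> 0 \<longrightarrow> \<not> (c (i + 1) = 1 \<and> c i = 1))"

definition gamma :: "nat \<Rightarrow> int \<Rightarrow> nat" where
  "gamma N = (if \<exists>c. one_one_rep N c then THE c. one_one_rep N c else beta N)"

text \<open>
  A word with a point is a pair consisting of the letters to the left and the letters to the
  right of the point, both read from left to right.
\<close>

type_synonym pointed_word = "nat list \<times> nat list"

text \<open>
  The word of a digit sequence has no superfluous leading or trailing zeros, except that the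
  digit at index 0 is always written; the part right of the point may be empty.
\<close>

definition top_index :: "(int \<Rightarrow> nat) \<Rightarrow> int" where
  "top_index d = Max (insert 0 {i. d i \<noteq> 0})"

definition bottom_index :: "(int \<Rightarrow> nat) \<Rightarrow> int" where
  "bottom_index d = Min (insert 0 {i. d i \<noteq> 0})"

definition word_of :: "(int \<Rightarrow> nat) \<Rightarrow> pointed_word" where
  "word_of d = (map d (rev [0..top_index d]), map d (rev [bottom_index d..-1]))"

fun digit_of :: "pointed_word \<Rightarrow> int \<Rightarrow> nat" where
  "digit_of (l, r) i =
     (if 0 \<le> i \<and> i < int (length l) then rev l ! nat i
      else if - int (length r) \<le> i \<and> i < 0 then r ! nat (- i - 1)
      else 0)"

text \<open>
  \<open>affix_replacement p u w v s w'\<close> says that \<open>w' = p u\<^sup>-\<^sup>1 w v\<^sup>-\<^sup>1 s\<close>. This includes the claims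
  that \<open>w\<close> begins with \<open>u\<close> and ends with \<open>v\<close>; the removed prefix lies to the left and the
  removed suffix to the right of the point.
\<close>

definition affix_replacement ::
  "nat list \<Rightarrow> nat list \<Rightarrow> pointed_word \<Rightarrow> nat list \<Rightarrow> nat list \<Rightarrow> pointed_word \<Rightarrow> bool" where
  "affix_replacement p u w v s w' \<longleftrightarrow>
     (\<exists>x y. w = (u @ x, y @ v) \<and> w' = (p @ x, y @ s))"

end

theory Submission
  imports Defs
begin

text \<open>
  A real number has at most one finite expansion without adjacent ones (greedy comparison at the
  highest index where two expansions differ). A representation containing the pair
  \<open>11\<close> at indices 1 and 0 becomes sparse by carrying, so \<open>N\<close> has one if and only if the Bergman
  representation has digit 0 at index -1 and its lowest nonzero digit at a nonnegative index sits
  at an even index \<open>\<ge> 2\<close>. The digit changes in the theorem add the right Lucas number, create no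
  new adjacent ones, and preserve this criterion, because the new leading one at \<open>2n + 1\<close> has an
  odd index; hence they carry canonical representations to canonical ones. That
  the words have room for the changes (prefix \<open>10\<close>, suffix \<open>01\<close>, and even \<open>001\<close> for
  \<open>L\<^sub>2\<^sub>n\<^sub>-\<^sub>1 < N \<le> L\<^sub>2\<^sub>n\<close>) follows by induction along the same recursion.
\<close>

section \<open>Sparse expansions\<close>

text \<open>Digit sequences over {0, 1} are encoded by their supports: digit changes become
  insertions and removals, and adjacency becomes membership.\<close>

definition digits :: "int set \<Rightarrow> int \<Rightarrow> nat" where
  "digits S i = of_bool (i \<in> S)"

definition val :: "int set \<Rightarrow> real" where
  "val S = (\<Sum>i\<in>S. golden powi i)"

definition sparse :: "int set \<Rightarrow> bool" where
  "sparse S \<longleftrightarrow> (\<forall>i\<in>S. i + 1 \<notin> S)"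

definition paired :: "int set \<Rightarrow> bool" where
  "paired S \<longleftrightarrow> 0 \<in> S \<and> 1 \<in> S \<and> (\<forall>i\<in>S. i \<noteq> 0 \<longrightarrow> i + 1 \<notin> S)"

text \<open>For the support of a sparse expansion: undoing carries produces the pair \<open>11\<close> at indices 1, 0.\<close>

definition unfoldable :: "int set \<Rightarrow> bool" where
  "unfoldable S \<longleftrightarrow> -1 \<notin> S \<and> (\<exists>m\<ge>1. 2 * m \<in> S \<and> (\<forall>i. 0 \<le> i \<and> i < 2 * m \<longrightarrow> i \<notin> S))"

text \<open>Turns the two-case definition of \<open>gamma\<close> into a test on one support: in the
  sparse case, failure of \<open>unfoldable\<close> rules out any paired representation.
  \<open>gamma_canonical\<close> shows that passing the test determines
  \<open>gamma N\<close>.\<close>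

definition canonical :: "nat \<Rightarrow> int set \<Rightarrow> bool" where
  "canonical N S \<longleftrightarrow> finite S \<and> real N = val S \<and> (paired S \<or> sparse S \<and> \<not> unfoldable S)"

section \<open>Powers of the golden ratio and values of finite supports\<close>

lemma golden_gt_1: "golden > 1"
  by (simp add: golden_def)

lemma golden_pos: "golden > 0"
  using golden_gt_1 by simp

lemma golden_square: "golden * golden = golden + 1"
  by (simp add: golden_def field_simps)

lemma golden_powi_pos [simp]: "golden powi i > 0"
  using golden_pos by simp

lemma golden_powi_rec: "golden powi (i + 2) = golden powi (i + 1) + golden powi i"
proof -
  have "golden powi (i + 2) = golden powi i * (golden * golden)"
    using golden_pos by (simp add: power_int_add power2_eq_square)
  then show ?thesis
    using golden_pos by (simp add: golden_square power_int_add algebra_simps)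
qed

text \<open>The recursion with its index relations as premises, so that consecutive exponents fit
  however they are written.\<close>

lemma golden_powi_split: "j = i + 1 \<Longrightarrow> k = i + 2 \<Longrightarrow> golden powi k = golden powi j + golden powi i"
  using golden_powi_rec by simp

lemma golden_powi_mono: "i \<le> j \<Longrightarrow> golden powi i \<le> golden powi j"
  using golden_gt_1 by (simp add: power_int_increasing)

lemma val_insert [simp]: "finite S \<Longrightarrow> i \<notin> S \<Longrightarrow> val (insert i S) = golden powi i + val S"
  by (simp add: val_def)

lemma val_remove: "finite S \<Longrightarrow> i \<in> S \<Longrightarrow> val (S - {i}) = val S - golden powi i"
  by (simp add: val_def sum_diff1)

lemma val_Un: "finite A \<Longrightarrow> finite B \<Longrightarrow> A \<inter> B = {} \<Longrightarrow> val (A \<union> B) = val A + val B"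
  by (simp add: val_def sum.union_disjoint)

lemma val_nonneg: "val S \<ge> 0"
  unfolding val_def by (intro sum_nonneg less_imp_le golden_powi_pos)

text \<open>Without its top index t the support lies below t - 1, so by induction the value is less
  than \<phi>^t + \<phi>^(t-1) = \<phi>^(t+1).\<close>

lemma sparse_val_less:
  assumes "finite S" "sparse S" "\<forall>i\<in>S. i < m"
  shows "val S < golden powi m"
  using assms
proof (induction S arbitrary: m rule: finite_psubset_induct)
  case (psubset S)
  show ?case
  proof (cases "S = {}")
    case True
    then show ?thesis by (simp add: val_def)
  next
    case False
    define t where "t = Max S"
    have t: "t \<in> S" "\<forall>i\<in>S. i \<le> t"
      using False psubset.hyps by (auto simp: t_def)
    have "i < t - 1" if "i \<in> S - {t}" for i
    proof -
      have "i \<noteq> t - 1"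
        using that t psubset.prems(1) unfolding sparse_def by force
      with that t show ?thesis by force
    qed
    then have "val (S - {t}) < golden powi (t - 1)"
      using t psubset.prems by (intro psubset.IH) (auto simp: sparse_def)
    then have "val S < golden powi (t + 1)"
      using golden_powi_split[of t "t - 1" "t + 1"] t psubset.hyps by (simp add: val_remove)
    also have "\<dots> \<le> golden powi m"
      using t psubset.prems by (intro golden_powi_mono) force
    finally show ?thesis .
  qed
qed

text \<open>The parts above m agree. At m and below, \<open>S\<close> contributes at least \<phi>^m
  and the sparse \<open>S'\<close> contributes less.\<close>

lemma sparse_val_neq:
  assumes "finite S" "finite S'" "sparse S'" "m \<in> S" "m \<notin> S'"
    and above: "\<forall>i>m. i \<in> S \<longleftrightarrow> i \<in> S'"
  shows "val S \<noteq> val S'"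
proof -
  have S: "S = {i\<in>S. i \<ge> m} \<union> {i\<in>S. i < m}" by auto
  have "val S = val {i\<in>S. i \<ge> m} + val {i\<in>S. i < m}"
    using assms(1) by (subst S, intro val_Un) auto
  moreover have "{i\<in>S. i \<ge> m} = insert m {i\<in>S'. i > m}"
    using assms by (auto simp: le_less)
  ultimately have 1: "val S \<ge> golden powi m + val {i\<in>S'. i > m}"
    using assms(2) val_nonneg by simp
  have S': "S' = {i\<in>S'. i > m} \<union> {i\<in>S'. i < m}"
    using assms(5) linorder_less_linear[of _ m] by blast
  have 2: "val S' = val {i\<in>S'. i > m} + val {i\<in>S'. i < m}"
    using assms(2) by (subst S', intro val_Un) auto
  have 3: "val {i\<in>S'. i < m} < golden powi m"
    using assms by (intro sparse_val_less) (auto simp: sparse_def)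
  from 1 2 3 show ?thesis by simp
qed

lemma sparse_unique:
  assumes "finite S" "finite S'" "sparse S" "sparse S'" "val S = val S'"
  shows "S = S'"
proof (rule ccontr)
  assume "S \<noteq> S'"
  define D where "D = (S - S') \<union> (S' - S)"
  have D: "finite D" "D \<noteq> {}"
    using assms \<open>S \<noteq> S'\<close> by (auto simp: D_def)
  define m where "m = Max D"
  have "m \<in> D" using D by (simp add: m_def)
  have above: "i \<in> S \<longleftrightarrow> i \<in> S'" if "i > m" for i
  proof -
    have "i \<notin> D" using that D by (auto simp: m_def)
    then show ?thesis by (auto simp: D_def)
  qed
  show False
    using \<open>m \<in> D\<close> above assms sparse_val_neq[of S S' m] sparse_val_neq[of S' S m]
    by (auto simp: D_def)
qed

section \<open>Identifying the canonical representation\<close>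

lemma digits_eq_Suc_0 [simp]: "digits S i = Suc 0 \<longleftrightarrow> i \<in> S"
  by (simp add: digits_def)

lemma binary_rep_digits: "binary_rep N (digits S) \<longleftrightarrow> finite S \<and> real N = val S"
  by (auto simp: binary_rep_def digits_def val_def)

lemma binary_repE:
  assumes "binary_rep N d"
  obtains S where "d = digits S"
proof
  show "d = digits {i. d i \<noteq> 0}"
    using assms by (force simp: binary_rep_def digits_def)
qed

lemma bergman_rep_digits: "bergman_rep N (digits S) \<longleftrightarrow> finite S \<and> real N = val S \<and> sparse S"
  by (auto simp: bergman_rep_def binary_rep_digits sparse_def)

lemma one_one_rep_digits: "one_one_rep N (digits S) \<longleftrightarrow> finite S \<and> real N = val S \<and> paired S"
  by (auto simp: one_one_rep_def binary_rep_digits paired_def)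

text \<open>Removing 0 and 1 from both supports leaves sparse supports of equal value.\<close>

lemma paired_unique:
  assumes "finite S" "finite S'" "paired S" "paired S'" "val S = val S'"
  shows "S = S'"
proof -
  have "S - {0} - {1} = S' - {0} - {1}"
    using assms by (intro sparse_unique) (auto simp: paired_def sparse_def val_remove)
  then show ?thesis
    using assms(3,4) by (auto simp: paired_def)
qed

text \<open>The sum 1 + \<phi> + \<phi>^3 + ... + \<phi>^(2m-1) collapses by repeated
  carrying.\<close>

lemma val_alternating:
  "val (insert 0 ((\<lambda>j. 2 * int j + 1) ` {..<m})) = golden powi (2 * int m)"
proof (induction m)
  case 0
  then show ?case by (simp add: val_def)
next
  case (Suc m)
  have "insert 0 ((\<lambda>j. 2 * int j + 1) ` {..<Suc m}) =
        insert (2 * int m + 1) (insert 0 ((\<lambda>j. 2 * int j + 1) ` {..<m}))"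
    by (auto simp: lessThan_Suc)
  moreover have "2 * int m + 1 \<notin> insert 0 ((\<lambda>j. 2 * int j + 1) ` {..<m})"
    by auto
  ultimately show ?case
    using Suc golden_powi_rec[of "2 * int m"] by (simp add: algebra_simps)
qed

text \<open>Carrying turns the block \<open>0(10)\<^sup>m\<^sup>-\<^sup>111\<close> above the point into \<open>10\<^sup>2\<^sup>m\<close>, which is sparse.\<close>

lemma paired_imp_unfoldable:
  assumes "finite C" "paired C" "finite S" "sparse S" "val S = val C"
  shows "unfoldable S"
proof -
  have inj: "inj (\<lambda>j. 2 * int j + 1)" by (auto simp: inj_def)
  have "finite {j. 2 * int j + 1 \<in> C}"
    using finite_vimageI[OF assms(1) inj] by (simp add: vimage_def)
  then have ex: "\<exists>j. 2 * int j + 1 \<notin> C"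
    using ex_new_if_finite[OF infinite_UNIV_nat] by blast
  \<comment> \<open>The block of ones at 1, 3, ..., 2m - 1 is taken maximal, so that 2m + 1 is free
    and the carry into 2m creates no adjacent pair.\<close>
  define m where "m = (LEAST j. 2 * int j + 1 \<notin> C)"
  have m: "2 * int m + 1 \<notin> C"
    unfolding m_def by (rule LeastI_ex[OF ex])
  have below: "2 * int j + 1 \<in> C" if "j < m" for j
    using not_less_Least[of j "\<lambda>j. 2 * int j + 1 \<notin> C"] that unfolding m_def by blast
  have "m \<noteq> 0"
    using m assms(2) by (auto simp: paired_def)
  have even: "2 * int j \<notin> C" if "1 \<le> j" "j \<le> m" for j
  proof -
    have "2 * int (j - 1) + 1 \<in> C" using below[of "j - 1"] that by simp
    moreover have "2 * int (j - 1) + 1 \<noteq> 0" "2 * int (j - 1) + 1 + 1 = 2 * int j"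
      using that by (auto simp: of_nat_diff)
    ultimately show ?thesis using assms(2) unfolding paired_def by metis
  qed
  define A where "A = insert 0 ((\<lambda>j. 2 * int j + 1) ` {..<m})"
  have A: "A \<subseteq> C" "finite A"
    using below assms(2) by (auto simp: A_def paired_def)
  \<comment> \<open>\<open>A\<close> exhausts the part of \<open>C\<close> from 0 to 2m, since each
    of the indices 2, 4, ..., 2m has a one directly below it.\<close>
  have A_iff: "i \<in> A" if "i \<in> C" "0 \<le> i" "i \<le> 2 * int m" for i
  proof (cases "even i")
    case True
    then obtain q where "i = 2 * q" by blast
    with that have "i = 2 * int (nat q)" "nat q \<le> m" by auto
    with even[of "nat q"] that show ?thesis
      by (cases "nat q = 0") (auto simp: A_def)
  next
    case False
    then obtain q where "i = 2 * q + 1" by (blast elim: oddE)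
    with that have "i = 2 * int (nat q) + 1" "nat q < m" by auto
    then show ?thesis unfolding A_def by blast
  qed
  have neg: "-1 \<notin> C"
    using assms(2) by (force simp: paired_def)
  define S' where "S' = insert (2 * int m) (C - A)"
  have range: "i < 0 \<or> i > 2 * int m + 1" if "i \<in> C - A" for i
    using that A_iff[of i] m by (cases "i = 2 * int m + 1") force+
  have "2 * int m \<notin> C"
    using even[of m] \<open>m \<noteq> 0\<close> by simp
  then have "val S' = golden powi (2 * int m) + val (C - A)"
    using assms(1) by (simp add: S'_def)
  also have "\<dots> = val (A \<union> (C - A))"
    using A assms(1) val_alternating[of m]
    by (subst val_Un) (auto simp flip: A_def intro: finite_subset)
  also have "A \<union> (C - A) = C" using A by auto
  finally have "val S' = val C" .
  moreover have "sparse S'"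
    unfolding sparse_def
  proof
    fix i assume i: "i \<in> S'"
    show "i + 1 \<notin> S'"
    proof
      assume i': "i + 1 \<in> S'"
      have "i \<noteq> 2 * int m"
        using i' m by (auto simp: S'_def)
      then have iC: "i \<in> C - A" using i by (auto simp: S'_def)
      show False
      proof (cases "i + 1 = 2 * int m")
        case True
        with range[OF iC] \<open>m \<noteq> 0\<close> show False by auto
      next
        case False
        then have "i + 1 \<in> C - A" using i' by (auto simp: S'_def)
        moreover have "i \<noteq> 0" using range[OF iC] by auto
        ultimately show False
          using assms(2) iC by (auto simp: paired_def)
      qed
    qed
  qed
  ultimately have "S = S'"
    using assms by (intro sparse_unique) (auto simp: S'_def)
  \<comment> \<open>The carried one at 2m is the lowest one at a nonnegative index.\<close>
  moreover have "unfoldable S'"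
    unfolding unfoldable_def
    using neg range \<open>m \<noteq> 0\<close> by (auto simp: S'_def intro!: exI[of _ "int m"]) force+
  ultimately show ?thesis by simp
qed

text \<open>If \<open>S\<close> is paired, uniqueness of paired supports settles the first branch of
  \<open>gamma\<close>. Otherwise a paired representation would make \<open>S\<close> unfoldable, so
  \<open>gamma\<close> falls back to \<open>beta\<close>, which uniqueness of sparse supports
  identifies.\<close>

lemma gamma_canonical:
  assumes "canonical N S"
  shows "gamma N = digits S"
proof (cases "paired S")
  case True
  then have "one_one_rep N (digits S)"
    using assms by (simp add: canonical_def one_one_rep_digits)
  moreover have "c = digits S" if c: "one_one_rep N c" for c
  proof -
    obtain C where "c = digits C"
      using c binary_repE by (auto simp: one_one_rep_def)
    with c True assms show ?thesis
      using paired_unique[of C S] by (auto simp: canonical_def one_one_rep_digits)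
  qed
  ultimately have "\<exists>!c. one_one_rep N c" "(THE c. one_one_rep N c) = digits S"
    by (blast, blast intro: the_equality)
  then show ?thesis
    unfolding gamma_def by (metis (no_types, lifting))
next
  case False
  then have S: "finite S" "real N = val S" "sparse S" "\<not> unfoldable S"
    using assms by (auto simp: canonical_def)
  have "\<not> one_one_rep N c" for c
  proof
    assume c: "one_one_rep N c"
    obtain C where "c = digits C"
      using c binary_repE by (auto simp: one_one_rep_def)
    with c S show False
      using paired_imp_unfoldable[of C S] by (auto simp: one_one_rep_digits)
  qed
  moreover have "beta N = digits S"
    unfolding beta_def
  proof (rule the_equality)
    show "bergman_rep N (digits S)" using S by (simp add: bergman_rep_digits)
    fix c assume c: "bergman_rep N c"
    obtain C where "c = digits C"
      using c binary_repE by (auto simp: bergman_rep_def)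
    with c S show "c = digits S"
      using sparse_unique[of C S] by (auto simp: bergman_rep_digits)
  qed
  ultimately show ?thesis by (simp add: gamma_def)
qed

text \<open>A sparse support with only negative indices has value below \<phi>^0 = 1.\<close>

lemma canonical_ex_nonneg:
  assumes "canonical N S" "N \<ge> 1"
  shows "\<exists>i\<in>S. i \<ge> 0"
proof (cases "paired S")
  case True
  then show ?thesis by (auto simp: paired_def)
next
  case False
  then have "\<not> val S < golden powi 0"
    using assms by (auto simp: canonical_def)
  then show ?thesis
    using sparse_val_less[of S 0] assms False by (force simp: canonical_def)
qed

section \<open>The four steps of the recursion\<close>

text \<open>Binet's formula, with the powers of the conjugate root -1/\<phi> written as signed
  negative powers of \<phi>. Both parities are proved together because the recursion for each uses
  the other.\<close>

lemma lucas_golden: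
  "real (lucas (2 * n)) = golden powi (2 * int n) + golden powi (- (2 * int n)) \<and>
   real (lucas (2 * n + 1)) = golden powi (2 * int n + 1) - golden powi (- (2 * int n) - 1)"
proof (induction n)
  case 0
  have "inverse golden = golden - 1"
    using golden_square golden_pos by (simp add: field_simps)
  then show ?case by simp
next
  case (Suc n)
  have 1: "lucas (2 * Suc n) = lucas (2 * n + 1) + lucas (2 * n)"
    "lucas (2 * Suc n + 1) = lucas (2 * Suc n) + lucas (2 * n + 1)"
    by simp_all
  have 2: "golden powi (2 * int (Suc n)) = golden powi (2 * int n + 1) + golden powi (2 * int n)"
    "golden powi (2 * int (Suc n) + 1) = golden powi (2 * int (Suc n)) + golden powi (2 * int n + 1)"
    "golden powi (- (2 * int n)) = golden powi (- (2 * int n) - 1) + golden powi (- (2 * int (Suc n)))"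
    "golden powi (- (2 * int n) - 1) =
      golden powi (- (2 * int (Suc n))) + golden powi (- (2 * int (Suc n)) - 1)"
    by (rule golden_powi_split; simp)+
  show ?case
    using Suc unfolding 1 of_nat_add by (simp only: 2) simp
qed

lemmas lucas_even = lucas_golden[THEN conjunct1] and lucas_odd = lucas_golden[THEN conjunct2]

text \<open>Room for the affix replacements: if t \<ge> 1 and b \<le> -2, the word starts with 10
  left of the point and ends with 01 right of it.\<close>

definition framed :: "int \<Rightarrow> int \<Rightarrow> int set \<Rightarrow> bool" where
  "framed t b S \<longleftrightarrow> S \<subseteq> {b..t} \<and> t \<in> S \<and> b \<in> S \<and> t - 1 \<notin> S \<and> b + 1 \<notin> S"

text \<open>Adds the two powers \<phi>^(2n) and \<phi>^(-2n) that make up L(2n).\<close>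

definition step_even :: "nat \<Rightarrow> int set \<Rightarrow> int set" where
  "step_even n S = insert (2 * int n) (insert (- 2 * int n) S)"

text \<open>Adds L(2n) to a support with ones at 2n - 1 and -2n, by \<phi>^(2n) + \<phi>^(2n-1) =
  \<phi>^(2n+1) and 2 \<phi>^(-2n) = \<phi>^(-2n+1) + \<phi>^(-2n-2).\<close>

definition step_odd_low :: "nat \<Rightarrow> int set \<Rightarrow> int set" where
  "step_odd_low n S = insert (2 * int n + 1) (insert (- 2 * int n + 1) (insert (- 2 * int n - 2)
     (S - {2 * int n - 1} - {- 2 * int n})))"

text \<open>Adds L(2n+1) = \<phi>^(2n+1) - \<phi>^(-2n-1) to a support with a one at -2n + 2, by
  \<phi>^(-2n+2) - \<phi>^(-2n-1) = \<phi>^(-2n+1) + \<phi>^(-2n-2).\<close>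

definition step_odd_mid :: "nat \<Rightarrow> int set \<Rightarrow> int set" where
  "step_odd_mid n S = insert (2 * int n + 1) (insert (- 2 * int n + 1) (insert (- 2 * int n - 2)
     (S - {- 2 * int n + 2})))"

text \<open>Adds L(2n+1) to a support with a one at -2n, by \<phi>^(-2n) - \<phi>^(-2n-1) =
  \<phi>^(-2n-2).\<close>

definition step_odd_high :: "nat \<Rightarrow> int set \<Rightarrow> int set" where
  "step_odd_high n S = insert (2 * int n + 1) (insert (- 2 * int n - 2) (S - {- 2 * int n}))"

lemma framed_cases:
  assumes "framed t b S" "i \<in> S"
  shows "i = b \<or> i = t \<or> b + 2 \<le> i \<and> i \<le> t - 2"
proof -
  have "b \<le> i" "i \<le> t" "i \<noteq> t - 1" "i \<noteq> b + 1"
    using assms by (auto simp: framed_def)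
  then show ?thesis by linarith
qed

text \<open>Stated so that one check for new adjacent pairs serves both the sparse and the paired
  case of a step.\<close>

lemma sparse_adjacent:
  "sparse S \<Longrightarrow> (\<And>i. i \<in> S' \<Longrightarrow> i + 1 \<in> S' \<Longrightarrow> i \<in> S \<and> i + 1 \<in> S) \<Longrightarrow> sparse S'"
  unfolding sparse_def by blast

lemma paired_adjacent:
  "paired S \<Longrightarrow> (\<And>i. i \<in> S' \<Longrightarrow> i + 1 \<in> S' \<Longrightarrow> i \<in> S \<and> i + 1 \<in> S) \<Longrightarrow>
    0 \<in> S' \<Longrightarrow> 1 \<in> S' \<Longrightarrow> paired S'"
  unfolding paired_def by blast

text \<open>Sparse and paired supports keep their kind; unfoldability is pulled back to the old
  support, so its absence carries over to the new one.\<close>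

lemma canonical_step:
  assumes "canonical N S" "finite S'" "real N' = val S'"
    and "paired S \<Longrightarrow> paired S'"
    and "sparse S \<Longrightarrow> sparse S'"
    and "unfoldable S' \<Longrightarrow> unfoldable S"
  shows "canonical N' S'"
  using assms by (auto simp: canonical_def)

lemma canonical_step_even:
  assumes "canonical k S" "1 \<le> k" "1 \<le> n" "S \<subseteq> {- 2 * int n + 2..2 * int n - 2}"
  shows "canonical (lucas (2 * n) + k) (step_even n S)"
proof (rule canonical_step[OF assms(1)])
  have notin: "2 * int n \<notin> S" "- 2 * int n \<notin> S" "2 * int n + 1 \<notin> S" "2 * int n - 1 \<notin> S"
    "- 2 * int n + 1 \<notin> S" "- 2 * int n - 1 \<notin> S"
    using assms(4) by auto
  have gap: "- 2 * int n + 2 \<le> i \<and> i \<le> 2 * int n - 2" if "i \<in> S" for i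
    using that assms(4) by auto
  have fin: "finite S" and val: "real k = val S"
    using assms(1) by (auto simp: canonical_def)
  show "finite (step_even n S)"
    using fin by (simp add: step_even_def)
  show "real (lucas (2 * n) + k) = val (step_even n S)"
    using fin val notin assms(3) lucas_even[of n] by (simp add: step_even_def)
  have adjacent: "i \<in> S \<and> i + 1 \<in> S" if "i \<in> step_even n S" "i + 1 \<in> step_even n S" for i
    using that gap[of i] gap[of "i + 1"] assms(3)
    unfolding step_even_def insert_iff Diff_iff empty_iff simp_thms by linarith
  show "sparse (step_even n S)" if "sparse S"
    using that adjacent by (rule sparse_adjacent)
  show "paired (step_even n S)" if "paired S"
    using that adjacent
  proof (rule paired_adjacent)
    show "0 \<in> step_even n S" "1 \<in> step_even n S"
      using that assms(2,3) by (auto simp: paired_def step_even_def)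
  qed
  \<comment> \<open>The new one at 2n has an even index and could pass for the witness of
    \<open>unfoldable\<close>; a nonnegative index of \<open>S\<close>, which lies below 2n,
    prevents this.\<close>
  obtain j where j: "j \<in> S" "j \<ge> 0"
    using canonical_ex_nonneg[OF assms(1,2)] by blast
  with gap have "j < 2 * int n" by force
  show "unfoldable S" if T: "unfoldable (step_even n S)"
  proof -
    obtain m where m: "m \<ge> 1" "2 * m \<in> step_even n S" "\<forall>i. 0 \<le> i \<and> i < 2 * m \<longrightarrow> i \<notin> step_even n S"
      using T by (auto simp: unfoldable_def)
    have "2 * m \<le> j" using m(3) j by (force simp: step_even_def)
    then have "2 * m \<in> S" using m(1,2) \<open>j < 2 * int n\<close> by (auto simp: step_even_def)
    then show ?thesis
      using T m unfolding unfoldable_def step_even_def by blast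
  qed
qed

text \<open>The hypothesis on -2n + 2 keeps the new one at -2n + 1 isolated; the frame takes care of
  the other places.\<close>

lemma canonical_step_odd_low:
  assumes "canonical N S" "2 \<le> n" "framed (2 * int n - 1) (- 2 * int n) S" "- 2 * int n + 2 \<notin> S"
  shows "canonical (lucas (2 * n) + N) (step_odd_low n S)"
proof (rule canonical_step[OF assms(1)])
  have mem: "2 * int n - 1 \<in> S" "- 2 * int n \<in> S" "2 * int n - 2 \<notin> S" "- 2 * int n + 1 \<notin> S"
    "S \<subseteq> {- 2 * int n..2 * int n - 1}"
    using assms(3) by (auto simp: framed_def)
  have notin: "2 * int n \<notin> S" "2 * int n + 1 \<notin> S" "2 * int n + 2 \<notin> S"
    "- 2 * int n - 1 \<notin> S" "- 2 * int n - 2 \<notin> S" "- 2 * int n - 3 \<notin> S"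
    using mem(5) by auto
  have gap: "i = - 2 * int n \<or> i = 2 * int n - 1 \<or> - 2 * int n + 3 \<le> i \<and> i \<le> 2 * int n - 3"
    if "i \<in> S" for i
    using framed_cases[OF assms(3) that] that assms(4) by (cases "i = - 2 * int n + 2") auto
  have fin: "finite S" and val: "real N = val S"
    using assms(1) by (auto simp: canonical_def)
  show "finite (step_odd_low n S)"
    using fin by (simp add: step_odd_low_def)
  have shift: "golden powi (2 * int n + 1) = golden powi (2 * int n) + golden powi (2 * int n - 1)"
    "golden powi (1 - 2 * int n) = golden powi (- (2 * int n)) + golden powi (- (2 * int n) - 1)"
    "golden powi (- (2 * int n)) = golden powi (- (2 * int n) - 1) + golden powi (- (2 * int n) - 2)"
    by (rule golden_powi_split; simp)+
  show "real (lucas (2 * n) + N) = val (step_odd_low n S)"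
  proof -
    have "val (step_odd_low n S) = golden powi (2 * int n + 1) + (golden powi (1 - 2 * int n) +
        (golden powi (- (2 * int n) - 2) +
        (val S - golden powi (2 * int n - 1) - golden powi (- (2 * int n)))))"
      using fin mem(1,2,4) notin assms(2) by (simp add: step_odd_low_def val_remove)
    then show ?thesis
      using val lucas_even[of n] shift by linarith
  qed
  have adjacent: "i \<in> S \<and> i + 1 \<in> S" if "i \<in> step_odd_low n S" "i + 1 \<in> step_odd_low n S" for i
    using that gap[of i] gap[of "i + 1"] assms(2)
    unfolding step_odd_low_def insert_iff Diff_iff empty_iff simp_thms by linarith
  show "sparse (step_odd_low n S)" if "sparse S"
    using that adjacent by (rule sparse_adjacent)
  show "paired (step_odd_low n S)" if "paired S"
    using that adjacent
  proof (rule paired_adjacent)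
    show "0 \<in> step_odd_low n S" "1 \<in> step_odd_low n S"
      using that assms(2) by (auto simp: paired_def step_odd_low_def)
  qed
  show "unfoldable S" if T: "unfoldable (step_odd_low n S)"
  proof -
    obtain m where m: "m \<ge> 1" "2 * m \<in> step_odd_low n S"
      "\<forall>i. 0 \<le> i \<and> i < 2 * m \<longrightarrow> i \<notin> step_odd_low n S"
      using T by (auto simp: unfoldable_def)
    \<comment> \<open>The new leading one has an odd index, so it is not the witness of
      \<open>unfoldable\<close>.\<close>
    have "2 * m \<noteq> 2 * int n + 1" by presburger
    then have 2: "2 * m \<in> S" using m(1,2) assms(2) by (auto simp: step_odd_low_def)
    have "i \<notin> S" if i: "0 \<le> i" "i < 2 * m" for i
    proof
      assume "i \<in> S"
      \<comment> \<open>The removed one at 2n - 1 is out of reach: 2m is in \<open>S\<close>, so i <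
        2m \<le> 2n - 1.\<close>
      moreover have "i \<noteq> 2 * int n - 1" using i 2 mem(5) by auto
      ultimately have "i \<in> step_odd_low n S" using i assms(2) by (auto simp: step_odd_low_def)
      with m i show False by blast
    qed
    moreover have "-1 \<notin> S" using T assms(2) by (auto simp: unfoldable_def step_odd_low_def)
    ultimately show ?thesis using 2 m(1) unfolding unfoldable_def by blast
  qed
qed

text \<open>At the bottom the one at -2n moves outwards to -2n - 2, and at the top 2n stays empty,
  so the frame alone excludes new adjacent pairs.\<close>

lemma canonical_step_odd_high:
  assumes "canonical N S" "2 \<le> n" "framed (2 * int n - 1) (- 2 * int n) S"
  shows "canonical (lucas (2 * n + 1) + N) (step_odd_high n S)"
proof (rule canonical_step[OF assms(1)])
  have mem: "2 * int n - 1 \<in> S" "- 2 * int n \<in> S" "2 * int n - 2 \<notin> S" "- 2 * int n + 1 \<notin> S"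
    "S \<subseteq> {- 2 * int n..2 * int n - 1}"
    using assms(3) by (auto simp: framed_def)
  have notin: "2 * int n \<notin> S" "2 * int n + 1 \<notin> S" "2 * int n + 2 \<notin> S"
    "- 2 * int n - 1 \<notin> S" "- 2 * int n - 2 \<notin> S" "- 2 * int n - 3 \<notin> S"
    using mem(5) by auto
  note gap = framed_cases[OF assms(3)]
  have fin: "finite S" and val: "real N = val S"
    using assms(1) by (auto simp: canonical_def)
  show "finite (step_odd_high n S)"
    using fin by (simp add: step_odd_high_def)
  have shift:
    "golden powi (- (2 * int n)) = golden powi (- (2 * int n) - 1) + golden powi (- (2 * int n) - 2)"
    by (rule golden_powi_split; simp)
  show "real (lucas (2 * n + 1) + N) = val (step_odd_high n S)"
  proof -
    have "val (step_odd_high n S) = golden powi (2 * int n + 1) +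
        (golden powi (- (2 * int n) - 2) + (val S - golden powi (- (2 * int n))))"
      using fin mem(2) notin assms(2) by (simp add: step_odd_high_def val_remove)
    then show ?thesis
      using val lucas_odd[of n] shift unfolding of_nat_add by linarith
  qed
  have adjacent: "i \<in> S \<and> i + 1 \<in> S" if "i \<in> step_odd_high n S" "i + 1 \<in> step_odd_high n S" for i
    using that gap[of i] gap[of "i + 1"] assms(2)
    unfolding step_odd_high_def insert_iff Diff_iff empty_iff simp_thms by linarith
  show "sparse (step_odd_high n S)" if "sparse S"
    using that adjacent by (rule sparse_adjacent)
  show "paired (step_odd_high n S)" if "paired S"
    using that adjacent
  proof (rule paired_adjacent)
    show "0 \<in> step_odd_high n S" "1 \<in> step_odd_high n S"
      using that assms(2) by (auto simp: paired_def step_odd_high_def)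
  qed
  show "unfoldable S" if T: "unfoldable (step_odd_high n S)"
  proof -
    obtain m where m: "m \<ge> 1" "2 * m \<in> step_odd_high n S"
      "\<forall>i. 0 \<le> i \<and> i < 2 * m \<longrightarrow> i \<notin> step_odd_high n S"
      using T by (auto simp: unfoldable_def)
    have "2 * m \<noteq> 2 * int n + 1" by presburger
    then have 2: "2 * m \<in> S" using m(1,2) by (auto simp: step_odd_high_def)
    have "i \<notin> S" if i: "0 \<le> i" "i < 2 * m" for i
      using i m(3)[rule_format, of i] assms(2) by (auto simp: step_odd_high_def)
    moreover have "-1 \<notin> S" using T assms(2) by (auto simp: unfoldable_def step_odd_high_def)
    ultimately show ?thesis using 2 m(1) unfolding unfoldable_def by blast
  qed
qed

text \<open>The new one at -2n + 1 is isolated because its upper neighbour is removed. Since n \<ge>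
  2, these changes lie below -1, so among the digits read by \<open>unfoldable\<close> only the one
  at the odd index 2n + 1 is new.\<close>

lemma canonical_step_odd_mid:
  assumes "canonical N S" "2 \<le> n" "framed (2 * int n - 2) (- 2 * int n + 2) S"
  shows "canonical (lucas (2 * n + 1) + N) (step_odd_mid n S)"
proof (rule canonical_step[OF assms(1)])
  have mem: "2 * int n - 2 \<in> S" "- 2 * int n + 2 \<in> S" "- 2 * int n + 3 \<notin> S"
    "S \<subseteq> {- 2 * int n + 2..2 * int n - 2}"
    using assms(3) by (auto simp: framed_def)
  have notin: "2 * int n \<notin> S" "2 * int n + 1 \<notin> S" "2 * int n + 2 \<notin> S"
    "- 2 * int n + 1 \<notin> S" "- 2 * int n \<notin> S"
    "- 2 * int n - 1 \<notin> S" "- 2 * int n - 2 \<notin> S" "- 2 * int n - 3 \<notin> S"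
    using mem(4) by auto
  note gap = framed_cases[OF assms(3)]
  have fin: "finite S" and val: "real N = val S"
    using assms(1) by (auto simp: canonical_def)
  show "finite (step_odd_mid n S)"
    using fin by (simp add: step_odd_mid_def)
  have shift:
    "golden powi (2 - 2 * int n) = golden powi (1 - 2 * int n) + golden powi (- (2 * int n))"
    "golden powi (- (2 * int n)) = golden powi (- (2 * int n) - 1) + golden powi (- (2 * int n) - 2)"
    by (rule golden_powi_split; simp)+
  show "real (lucas (2 * n + 1) + N) = val (step_odd_mid n S)"
  proof -
    have "val (step_odd_mid n S) = golden powi (2 * int n + 1) + (golden powi (1 - 2 * int n) +
        (golden powi (- (2 * int n) - 2) + (val S - golden powi (2 - 2 * int n))))"
      using fin mem(2) notin assms(2) by (simp add: step_odd_mid_def val_remove)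
    then show ?thesis
      using val lucas_odd[of n] shift unfolding of_nat_add by linarith
  qed
  have adjacent: "i \<in> S \<and> i + 1 \<in> S" if "i \<in> step_odd_mid n S" "i + 1 \<in> step_odd_mid n S" for i
    using that gap[of i] gap[of "i + 1"] assms(2)
    unfolding step_odd_mid_def insert_iff Diff_iff empty_iff simp_thms by linarith
  show "sparse (step_odd_mid n S)" if "sparse S"
    using that adjacent by (rule sparse_adjacent)
  show "paired (step_odd_mid n S)" if "paired S"
    using that adjacent
  proof (rule paired_adjacent)
    show "0 \<in> step_odd_mid n S" "1 \<in> step_odd_mid n S"
      using that assms(2) by (auto simp: paired_def step_odd_mid_def)
  qed
  show "unfoldable S" if T: "unfoldable (step_odd_mid n S)"
  proof -
    obtain m where m: "m \<ge> 1" "2 * m \<in> step_odd_mid n S"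
      "\<forall>i. 0 \<le> i \<and> i < 2 * m \<longrightarrow> i \<notin> step_odd_mid n S"
      using T by (auto simp: unfoldable_def)
    have "2 * m \<noteq> 2 * int n + 1" by presburger
    then have 2: "2 * m \<in> S" using m(1,2) assms(2) by (auto simp: step_odd_mid_def)
    have "i \<notin> S" if i: "0 \<le> i" "i < 2 * m" for i
      using i m(3)[rule_format, of i] assms(2) by (auto simp: step_odd_mid_def)
    moreover have "-1 \<notin> S" using T assms(2) by (auto simp: unfoldable_def step_odd_mid_def)
    ultimately show ?thesis using 2 m(1) unfolding unfoldable_def by blast
  qed
qed


section \<open>Frames of the supports produced by the steps\<close>

lemma framed_step_even:
  assumes "S \<subseteq> {- 2 * int n + 2..2 * int n - 2}" "1 \<le> n"
  shows "framed (2 * int n) (- 2 * int n) (step_even n S)"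
proof -
  have gap: "- 2 * int n + 2 \<le> i \<and> i \<le> 2 * int n - 2" if "i \<in> S" for i
    using that assms(1) by auto
  have sub: "step_even n S \<subseteq> {- 2 * int n..2 * int n}"
  proof
    fix i assume "i \<in> step_even n S"
    then show "i \<in> {- 2 * int n..2 * int n}"
      using gap[of i] by (auto simp: step_even_def)
  qed
  have "2 * int n - 1 \<notin> S" "- 2 * int n + 1 \<notin> S"
    using gap[of "2 * int n - 1"] gap[of "- 2 * int n + 1"] by linarith+
  then show ?thesis
    unfolding framed_def using assms(2)
    by (intro conjI sub) (auto simp: step_even_def)
qed

text \<open>The word ends in 001. For n - 1 in place of n, the extra zero is the hypothesis on -2n +
  2 in \<open>canonical_step_odd_low\<close>.\<close>

definition odd_framed :: "nat \<Rightarrow> int set \<Rightarrow> bool" where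
  "odd_framed n S \<longleftrightarrow> framed (2 * int n + 1) (- 2 * int n - 2) S \<and> - 2 * int n \<notin> S"

lemma odd_framed_step_odd_low:
  assumes "framed (2 * int n - 1) (- 2 * int n) S" "2 \<le> n"
  shows "odd_framed n (step_odd_low n S)"
proof -
  note gap = framed_cases[OF assms(1)]
  have sub: "step_odd_low n S \<subseteq> {- 2 * int n - 2..2 * int n + 1}"
  proof
    fix i assume "i \<in> step_odd_low n S"
    then show "i \<in> {- 2 * int n - 2..2 * int n + 1}"
      using gap[of i] assms(2) by (auto simp: step_odd_low_def)
  qed
  have "2 * int n + 1 - 1 \<notin> S" "- 2 * int n - 2 + 1 \<notin> S"
    using gap[of "2 * int n + 1 - 1"] gap[of "- 2 * int n - 2 + 1"] assms(2)
    by linarith+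
  then show ?thesis
    unfolding odd_framed_def framed_def using assms(2)
    by (intro conjI sub) (simp_all add: step_odd_low_def)
qed

lemma odd_framed_step_odd_mid:
  assumes "framed (2 * int n - 2) (- 2 * int n + 2) S" "2 \<le> n"
  shows "odd_framed n (step_odd_mid n S)"
proof -
  note gap = framed_cases[OF assms(1)]
  have sub: "step_odd_mid n S \<subseteq> {- 2 * int n - 2..2 * int n + 1}"
  proof
    fix i assume "i \<in> step_odd_mid n S"
    then show "i \<in> {- 2 * int n - 2..2 * int n + 1}"
      using gap[of i] assms(2) by (auto simp: step_odd_mid_def)
  qed
  have "2 * int n + 1 - 1 \<notin> S"
    using gap[of "2 * int n + 1 - 1"] assms(2) by linarith
  moreover have "- 2 * int n - 2 + 1 \<notin> S"
    using gap[of "- 2 * int n - 2 + 1"] assms(2) by linarith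
  moreover have "- 2 * int n \<notin> S"
    using gap[of "- 2 * int n"] assms(2) by linarith
  ultimately show ?thesis
    unfolding odd_framed_def framed_def using assms(2)
    by (intro conjI sub) (simp_all add: step_odd_mid_def)
qed

lemma odd_framed_step_odd_high:
  assumes "framed (2 * int n - 1) (- 2 * int n) S" "2 \<le> n"
  shows "odd_framed n (step_odd_high n S)"
proof -
  note gap = framed_cases[OF assms(1)]
  have sub: "step_odd_high n S \<subseteq> {- 2 * int n - 2..2 * int n + 1}"
  proof
    fix i assume "i \<in> step_odd_high n S"
    then show "i \<in> {- 2 * int n - 2..2 * int n + 1}"
      using gap[of i] assms(2) by (auto simp: step_odd_high_def)
  qed
  have "2 * int n + 1 - 1 \<notin> S" "- 2 * int n - 2 + 1 \<notin> S"
    using gap[of "2 * int n + 1 - 1"] gap[of "- 2 * int n - 2 + 1"] assms(2)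
    by linarith+
  then show ?thesis
    unfolding odd_framed_def framed_def using assms(2)
    by (intro conjI sub) (simp_all add: step_odd_high_def)
qed

section \<open>Shapes of the canonical representations\<close>

text \<open>The bound on the support is the room that \<open>canonical_step_even\<close> requires
  for n = m + 1.\<close>

definition small_shapes :: "nat \<Rightarrow> bool" where
  "small_shapes m \<longleftrightarrow> (\<forall>N. 1 \<le> N \<and> N \<le> lucas (2 * m + 1) \<longrightarrow>
     (\<exists>S. canonical N S \<and> S \<subseteq> {- 2 * int m..2 * int m}))"

text \<open>The frame is claimed from m = 1 on: for m = 0 the number 3 has the word 11.01, which
  does not start with 10.\<close>

definition odd_shapes :: "nat \<Rightarrow> bool" where
  "odd_shapes m \<longleftrightarrow> (\<forall>N. lucas (2 * m + 1) < N \<and> N \<le> lucas (2 * m + 2) \<longrightarrow>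
     (\<exists>S. canonical N S \<and> S \<subseteq> {- 2 * int m - 2..2 * int m + 1} \<and> (1 \<le> m \<longrightarrow> odd_framed m S)))"

text \<open>The initial ranges: 1 for \<open>small_shapes\<close>, 2 and 3 for the first case of
  \<open>odd_shapes\<close>, 5 to 7 for the second. The powers of \<phi> are reduced to integer
  combinations of 1 and \<phi>.\<close>

lemma canonical_base:
  shows "canonical 1 {0}" "canonical 2 {1, -2}" "canonical 3 {0, 1, -2}"
    "canonical 5 {3, -1, -4}" "canonical 6 {3, 1, -4}" "canonical 7 {3, 0, 1, -4}"
proof -
  have powi: "golden ^ 3 = 2 * golden + 1" "inverse golden = golden - 1"
    "golden powi (-2) = 2 - golden" "golden powi (-4) = 5 - 3 * golden"
    using golden_powi_rec[of 1] golden_powi_rec[of 0] golden_powi_rec[of "-1"]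
      golden_powi_rec[of "-2"] golden_powi_rec[of "-3"] golden_powi_rec[of "-4"]
    by simp_all
  have even: "2 * m \<noteq> 1" "2 * m \<noteq> 3" for m :: int
    by presburger+
  show "canonical 1 {0}" "canonical 2 {1, -2}" "canonical 3 {0, 1, -2}"
    "canonical 5 {3, -1, -4}" "canonical 6 {3, 1, -4}" "canonical 7 {3, 0, 1, -4}"
    using even by (auto simp: canonical_def val_def powi paired_def sparse_def unfoldable_def)
qed

text \<open>Subtracting L(2m+2) leaves a number from 1 to L(2m+1), to which the even step with n = m
  + 1 applies.\<close>

lemma even_shape:
  assumes "small_shapes m" "lucas (2 * m + 2) < N" "N \<le> lucas (2 * m + 3)"
  shows "\<exists>S. canonical N S \<and> framed (2 * int m + 2) (- 2 * int m - 2) S"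
proof -
  have N: "1 \<le> N - lucas (2 * m + 2)" "N - lucas (2 * m + 2) \<le> lucas (2 * m + 1)"
    using assms(2,3) by (auto simp: numeral_3_eq_3)
  then obtain S where S: "canonical (N - lucas (2 * m + 2)) S" "S \<subseteq> {- 2 * int m..2 * int m}"
    using assms(1) unfolding small_shapes_def by blast
  have "canonical N (step_even (Suc m) S)"
    using canonical_step_even[of "N - lucas (2 * m + 2)" S "Suc m"] S N assms(2) by simp
  moreover have "framed (2 * int m + 2) (- 2 * int m - 2) (step_even (Suc m) S)"
  proof -
    have eq: "2 * int m + 2 = 2 * int (Suc m)" "- 2 * int m - 2 = - 2 * int (Suc m)" by simp_all
    show ?thesis
      unfolding eq using S by (intro framed_step_even) auto
  qed
  ultimately show ?thesis by blast
qed

text \<open>The range from L(2n+1) to L(2n+2) is cut at L(2n+1) + L(2n-2) and L(2n+1) + L(2n-1); the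
  pieces arise by the low, mid and high step.\<close>

lemma odd_shape_step:
  assumes "small_shapes m" "odd_shapes (Suc m)"
  shows "odd_shapes (Suc (Suc m))"
proof -
  define n where "n = Suc (Suc m)"
  have n: "2 \<le> n" by (simp add: n_def)
  have odd: "\<exists>S. canonical N S \<and> framed (2 * int n - 1) (- 2 * int n) S \<and> - 2 * int n + 2 \<notin> S"
    if "lucas (2 * m + 3) < N" "N \<le> lucas (2 * m + 4)" for N
    using assms(2) that unfolding odd_shapes_def odd_framed_def
    by (auto simp: n_def eval_nat_numeral algebra_simps)
  have even: "\<exists>S. canonical N S \<and> framed (2 * int n - 2) (- 2 * int n + 2) S"
    if "lucas (2 * m + 2) < N" "N \<le> lucas (2 * m + 3)" for N
  proof -
    have eq: "2 * int n - 2 = 2 * int m + 2" "- 2 * int n + 2 = - 2 * int m - 2"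
      by (simp_all add: n_def)
    show ?thesis unfolding eq by (rule even_shape[OF assms(1) that])
  qed
  have luc: "lucas (2 * n) = lucas (2 * m + 4)" "lucas (2 * n + 1) = lucas (2 * m + 5)"
    "lucas (2 * n + 2) = lucas (2 * m + 5) + lucas (2 * m + 4)"
    "lucas (2 * m + 5) = lucas (2 * m + 4) + lucas (2 * m + 3)"
    "lucas (2 * m + 4) = lucas (2 * m + 3) + lucas (2 * m + 2)"
    by (simp_all add: n_def eval_nat_numeral)
  have "\<exists>S. canonical N S \<and> odd_framed n S"
    if N: "lucas (2 * n + 1) < N" "N \<le> lucas (2 * n + 2)" for N
  proof -
    \<comment> \<open>The first cut appears as 2 L(2n), which equals L(2n+1) + L(2n-2).\<close>
    consider "N - lucas (2 * n) \<le> lucas (2 * m + 4)"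
      | "lucas (2 * m + 4) < N - lucas (2 * n)" "N - lucas (2 * n + 1) \<le> lucas (2 * m + 3)"
      | "lucas (2 * m + 3) < N - lucas (2 * n + 1)"
      by linarith
    then show ?thesis
    proof cases
      case 1
      have "lucas (2 * m + 3) < N - lucas (2 * n)"
        using N luc by linarith
      then obtain S where "canonical (N - lucas (2 * n)) S"
        "framed (2 * int n - 1) (- 2 * int n) S" "- 2 * int n + 2 \<notin> S"
        using odd 1 by blast
      moreover have "lucas (2 * n) + (N - lucas (2 * n)) = N"
        using N luc by linarith
      ultimately show ?thesis
        using canonical_step_odd_low odd_framed_step_odd_low n by metis
    next
      case 2
      have "lucas (2 * m + 2) < N - lucas (2 * n + 1)"
        using 2 N luc by linarith
      then obtain S where "canonical (N - lucas (2 * n + 1)) S"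
        "framed (2 * int n - 2) (- 2 * int n + 2) S"
        using even 2 by blast
      moreover have "lucas (2 * n + 1) + (N - lucas (2 * n + 1)) = N"
        using N luc by linarith
      ultimately show ?thesis
        using canonical_step_odd_mid odd_framed_step_odd_mid n by metis
    next
      case 3
      have "N - lucas (2 * n + 1) \<le> lucas (2 * m + 4)"
        using N luc by linarith
      then obtain S where "canonical (N - lucas (2 * n + 1)) S"
        "framed (2 * int n - 1) (- 2 * int n) S"
        using odd 3 by blast
      moreover have "lucas (2 * n + 1) + (N - lucas (2 * n + 1)) = N"
        using N luc by linarith
      ultimately show ?thesis
        using canonical_step_odd_high odd_framed_step_odd_high n by metis
    qed
  qed
  then show ?thesis
    unfolding odd_shapes_def n_def odd_framed_def framed_def by blast
qed

text \<open>Two consecutive odd ranges are carried along: \<open>small_shapes (Suc m)\<close> uses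
  the one for m, \<open>odd_shape_step\<close> the one for m + 1.\<close>

lemma shapes: "small_shapes m \<and> odd_shapes m \<and> odd_shapes (Suc m)"
proof (induction m)
  case 0
  have "small_shapes 0"
    unfolding small_shapes_def using canonical_base(1) by (auto simp: le_Suc_eq)
  moreover have "odd_shapes 0"
    unfolding odd_shapes_def
  proof (intro allI impI, goal_cases)
    case (1 N)
    then have "N = 2 \<or> N = 3" by (auto simp: eval_nat_numeral)
    then show ?case
      using canonical_base(2,3) by (elim disjE) (auto intro: exI[of _ "{1, -2}"] exI[of _ "{0, 1, -2}"])
  qed
  moreover have "odd_shapes (Suc 0)"
    unfolding odd_shapes_def
  proof (intro allI impI, goal_cases)
    case (1 N)
    then have "N = 5 \<or> N = 6 \<or> N = 7" by (auto simp: eval_nat_numeral)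
    then show ?case
      using canonical_base(4-6)
      by (elim disjE) (auto simp: odd_framed_def framed_def
          intro: exI[of _ "{3, -1, -4}"] exI[of _ "{3, 1, -4}"] exI[of _ "{3, 0, 1, -4}"])
  qed
  ultimately show ?case by simp
next
  case (Suc m)
  have "\<exists>S. canonical N S \<and> S \<subseteq> {- 2 * int (Suc m)..2 * int (Suc m)}"
    if N: "1 \<le> N" "N \<le> lucas (2 * Suc m + 1)" for N
  proof -
    have eq: "lucas (2 * Suc m + 1) = lucas (2 * m + 3)"
      by (simp add: numeral_3_eq_3)
    consider "N \<le> lucas (2 * m + 1)" | "lucas (2 * m + 1) < N" "N \<le> lucas (2 * m + 2)"
      | "lucas (2 * m + 2) < N" "N \<le> lucas (2 * m + 3)"
      using N unfolding eq by linarith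
    then show ?thesis
    proof cases
      case 1
      then obtain S where "canonical N S" "S \<subseteq> {- 2 * int m..2 * int m}"
        using Suc N unfolding small_shapes_def by blast
      then show ?thesis by (intro exI[of _ S]) auto
    next
      case 2
      then obtain S where "canonical N S" "S \<subseteq> {- 2 * int m - 2..2 * int m + 1}"
        using Suc unfolding odd_shapes_def by blast
      then show ?thesis by (intro exI[of _ S]) auto
    next
      case 3
      then obtain S where "canonical N S" "framed (2 * int m + 2) (- 2 * int m - 2) S"
        using Suc even_shape by blast
      then show ?thesis by (intro exI[of _ S]) (auto simp: framed_def)
    qed
  qed
  then have "small_shapes (Suc m)"
    by (simp add: small_shapes_def)
  then show ?case
    using Suc odd_shape_step by blast
qed

section \<open>Words\<close>

lemma top_index_digits:
  assumes "S \<subseteq> {b..t}" "t \<in> S" "0 \<le> t"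
  shows "top_index (digits S) = t"
proof -
  have "{i. digits S i \<noteq> 0} = S" by (auto simp: digits_def)
  moreover have "finite S" using assms finite_subset by blast
  ultimately show ?thesis
    using assms unfolding top_index_def by (auto intro!: Max_eqI)
qed

lemma bottom_index_digits:
  assumes "S \<subseteq> {b..t}" "b \<in> S" "b \<le> 0"
  shows "bottom_index (digits S) = b"
proof -
  have "{i. digits S i \<noteq> 0} = S" by (auto simp: digits_def)
  moreover have "finite S" using assms finite_subset by blast
  ultimately show ?thesis
    using assms unfolding bottom_index_def by (auto intro!: Min_eqI)
qed

lemma word_of_digits:
  assumes "S \<subseteq> {b..t}" "t \<in> S" "b \<in> S" "0 \<le> t" "b \<le> 0"
  shows "word_of (digits S) = (map (digits S) (rev [0..t]), map (digits S) (rev [b..-1]))"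
  using assms by (simp add: word_of_def top_index_digits bottom_index_digits)

text \<open>The bound d \<le> c + 1 admits an empty second list, as needed when the removed suffix
  starts directly at the point.\<close>

lemma upto_append:
  fixes a b c d :: int
  assumes "a \<le> d" "d \<le> c + 1" "b = d - 1"
  shows "[a..c] = [a..b] @ [d..c]"
proof (cases "d \<le> c")
  case True
  then show ?thesis using assms upto_split1[of a d c] by simp
next
  case False
  then have "c = d - 1" using assms by simp
  then show ?thesis using assms by simp
qed

text \<open>Both supports agree between the two ends, so the words share the inner parts
  \<open>x\<close> and \<open>y\<close>. The bounds on t and b put the removed 10 left and the
  removed 01 right of the point.\<close>

lemma affix_replacement_digits:
  assumes S: "framed t b S" and S': "S' \<subseteq> {b'..t'}" "t' \<in> S'" "b' \<in> S'"
    and range: "1 \<le> t" "t \<le> t'" "b' \<le> b" "b \<le> -2"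
    and eq: "\<And>i. b + 2 \<le> i \<Longrightarrow> i \<le> t - 2 \<Longrightarrow> i \<in> S' \<longleftrightarrow> i \<in> S"
  shows "affix_replacement (map (digits S') (rev [t - 1..t'])) [1, 0] (word_of (digits S)) [0, 1]
    (map (digits S') (rev [b'..b + 1])) (word_of (digits S'))"
proof -
  define x where "x = map (digits S) (rev [0..t - 2])"
  define y where "y = map (digits S) (rev [b + 2..-1])"
  have x': "x = map (digits S') (rev [0..t - 2])"
    using eq range by (auto simp: x_def digits_def)
  have y': "y = map (digits S') (rev [b + 2..-1])"
    using eq range by (auto simp: y_def digits_def)
  have "[0..t] = [0..t - 2] @ [t - 1..t]" "[0..t'] = [0..t - 2] @ [t - 1..t']"
    "[b..-1] = [b..b + 1] @ [b + 2..-1]" "[b'..-1] = [b'..b + 1] @ [b + 2..-1]"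
    by (rule upto_append; use range in simp)+
  note split = this
  have t2: "[t - 1..t] = [t - 1, t]" and b2: "[b..b + 1] = [b, b + 1]"
    by (simp_all add: upto_rec1)
  have "word_of (digits S) = (map (digits S) (rev [0..t]), map (digits S) (rev [b..-1]))"
    using S range by (intro word_of_digits) (auto simp: framed_def)
  also have "\<dots> = ([1, 0] @ x, y @ [0, 1])"
    unfolding split t2 b2 using S by (simp add: x_def y_def) (simp add: framed_def digits_def)
  finally have 1: "word_of (digits S) = ([1, 0] @ x, y @ [0, 1])" .
  have "word_of (digits S') = (map (digits S') (rev [0..t']), map (digits S') (rev [b'..-1]))"
    using S' range by (intro word_of_digits) auto
  then have "word_of (digits S') =
      (map (digits S') (rev [t - 1..t']) @ x, y @ map (digits S') (rev [b'..b + 1]))"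
    unfolding split x' y' by simp
  with 1 show ?thesis
    unfolding affix_replacement_def by blast
qed

text \<open>The zeros fill the gaps between the ends of the old word and the new ones at 2n and -2n;
  the bound on \<open>S\<close> makes each gap nonempty.\<close>

lemma word_of_step_even:
  assumes "canonical k S" "1 \<le> k" "1 \<le> n" "S \<subseteq> {- 2 * int n + 2..2 * int n - 2}"
  shows "\<exists>a b l r. a \<ge> 1 \<and> b \<ge> 1 \<and> word_of (digits S) = (l, r) \<and>
    word_of (digits (step_even n S)) = (1 # replicate a 0 @ l, r @ replicate b 0 @ [1])"
proof -
  define t where "t = top_index (digits S)"
  define b where "b = bottom_index (digits S)"
  let ?d = "digits (step_even n S)"
  have supp: "{i. digits S i \<noteq> 0} = S" by (auto simp: digits_def)
  have fin: "finite S" using assms(1) by (simp add: canonical_def)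
  \<comment> \<open>Index 0 is always written, so t is nonnegative even if \<open>S\<close> has no
    positive index; n \<ge> 1 keeps 0 within the upper bound.\<close>
  have t: "0 \<le> t" "t \<le> 2 * int n - 2" "\<And>i. i \<in> S \<Longrightarrow> i \<le> t"
    unfolding t_def top_index_def supp using fin assms(3,4) by (auto simp: Max_ge_iff)
  have b: "b \<le> 0" "- 2 * int n + 2 \<le> b" "\<And>i. i \<in> S \<Longrightarrow> b \<le> i"
    unfolding b_def bottom_index_def supp using fin assms(3,4) by (auto simp: Min_le_iff)
  have upto: "[0..2 * int n] = [0..t] @ [t + 1..2 * int n - 1] @ [2 * int n]"
    "[- 2 * int n..-1] = [- 2 * int n] @ [- 2 * int n + 1..b - 1] @ [b..-1]"
  proof -
    have "[0..2 * int n] = [0..t] @ [t + 1..2 * int n]"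
      "[t + 1..2 * int n] = [t + 1..2 * int n - 1] @ [2 * int n..2 * int n]"
      "[- 2 * int n..-1] = [- 2 * int n..- 2 * int n] @ [- 2 * int n + 1..-1]"
      "[- 2 * int n + 1..-1] = [- 2 * int n + 1..b - 1] @ [b..-1]"
      by (rule upto_append; use t b assms(3) in simp)+
    then show "[0..2 * int n] = [0..t] @ [t + 1..2 * int n - 1] @ [2 * int n]"
      "[- 2 * int n..-1] = [- 2 * int n] @ [- 2 * int n + 1..b - 1] @ [b..-1]"
      by simp_all
  qed
  have eq: "map ?d (rev [0..t]) = map (digits S) (rev [0..t])"
    "map ?d (rev [b..-1]) = map (digits S) (rev [b..-1])"
    using t b by (auto simp: digits_def step_even_def)
  have zero: "map ?d (rev [t + 1..2 * int n - 1]) = replicate (nat (2 * int n - 1 - t)) 0"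
    "map ?d (rev [- 2 * int n + 1..b - 1]) = replicate (nat (b - 1 + 2 * int n)) 0"
    using t(2,3) b(2,3) t(1) b(1)
    by (force simp: digits_def step_even_def intro!: replicate_eqI)+
  have one: "?d (2 * int n) = 1" "?d (- 2 * int n) = 1"
    by (auto simp: digits_def step_even_def)
  have "word_of ?d = (map ?d (rev [0..2 * int n]), map ?d (rev [- 2 * int n..-1]))"
    using framed_step_even[OF assms(4,3)] by (intro word_of_digits) (auto simp: framed_def)
  also have "\<dots> = (1 # replicate (nat (2 * int n - 1 - t)) 0 @ map (digits S) (rev [0..t]),
      map (digits S) (rev [b..-1]) @ replicate (nat (b - 1 + 2 * int n)) 0 @ [1])"
    unfolding upto rev_append map_append eq zero using one by simp
  finally show ?thesis
    using t b by (intro exI[of _ "nat (2 * int n - 1 - t)"] exI[of _ "nat (b - 1 + 2 * int n)"])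
      (auto simp: word_of_def t_def b_def)
qed

lemma digit_of_outer_ones:
  assumes "1 \<le> n"
  shows "digit_of (1 # replicate (2 * n) 0, replicate (2 * n - 1) 0 @ [1]) i =
    of_bool (i = 2 * int n \<or> i = - 2 * int n)"
  using assms by (auto simp: nth_append nth_Cons')

lemma odd_affixes:
  assumes "framed (2 * int n - 1) (- 2 * int n) S" "2 \<le> n"
  shows
    "affix_replacement [1, 0, 0, 0] [1, 0] (word_of (digits S)) [0, 1] [1, 0, 0, 1]
      (word_of (digits (step_odd_low n S)))"
    "affix_replacement [1, 0, 1, 0] [1, 0] (word_of (digits S)) [0, 1] [0, 0, 0, 1]
      (word_of (digits (step_odd_high n S)))"
proof -
  have mem: "2 * int n - 1 \<in> S" "2 * int n - 1 - 1 \<notin> S" "- 2 * int n + 1 \<notin> S"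
    using assms(1) by (auto simp: framed_def)
  have notin: "2 * int n - 1 + 1 \<notin> S" "- 2 * int n - 1 \<notin> S"
    using framed_cases[OF assms(1), of "2 * int n - 1 + 1"]
      framed_cases[OF assms(1), of "- 2 * int n - 1"] assms(2) by linarith+
  \<comment> \<open>The indices keep the form t - 1 with t = 2n - 1, to match
    \<open>affix_replacement_digits\<close>.\<close>
  have "[2 * int n - 1 - 1..2 * int n + 1] =
      [2 * int n - 1 - 1, 2 * int n - 1, 2 * int n - 1 + 1, 2 * int n + 1]"
    "[- 2 * int n - 2..- 2 * int n + 1] =
      [- 2 * int n - 2, - 2 * int n - 1, - 2 * int n, - 2 * int n + 1]"
    by (simp_all add: upto_rec1)
  note upto = this
  have top: "map (digits (step_odd_low n S)) (rev [2 * int n - 1 - 1..2 * int n + 1]) = [1, 0, 0, 0]"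
    "map (digits (step_odd_high n S)) (rev [2 * int n - 1 - 1..2 * int n + 1]) = [1, 0, 1, 0]"
    unfolding upto using mem notin assms(2)
    by (auto simp: digits_def step_odd_low_def step_odd_high_def)
  have bottom: "map (digits (step_odd_low n S)) (rev [- 2 * int n - 2..- 2 * int n + 1]) = [1, 0, 0, 1]"
    "map (digits (step_odd_high n S)) (rev [- 2 * int n - 2..- 2 * int n + 1]) = [0, 0, 0, 1]"
    unfolding upto using mem notin assms(2)
    by (auto simp: digits_def step_odd_low_def step_odd_high_def)
  show "affix_replacement [1, 0, 0, 0] [1, 0] (word_of (digits S)) [0, 1] [1, 0, 0, 1]
      (word_of (digits (step_odd_low n S)))"
    unfolding top(1)[symmetric] bottom(1)[symmetric]
    using odd_framed_step_odd_low[OF assms] assms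
    by (intro affix_replacement_digits) (auto simp: odd_framed_def framed_def step_odd_low_def)
  show "affix_replacement [1, 0, 1, 0] [1, 0] (word_of (digits S)) [0, 1] [0, 0, 0, 1]
      (word_of (digits (step_odd_high n S)))"
    unfolding top(2)[symmetric] bottom(2)[symmetric]
    using odd_framed_step_odd_high[OF assms] assms
    by (intro affix_replacement_digits) (auto simp: odd_framed_def framed_def step_odd_high_def)
qed

lemma mid_affix:
  assumes "framed (2 * int n - 2) (- 2 * int n + 2) S" "2 \<le> n"
  shows "affix_replacement [1, 0, 0, 1, 0] [1, 0] (word_of (digits S)) [0, 1] [0, 0, 1, 0, 0, 1]
    (word_of (digits (step_odd_mid n S)))"
proof -
  have mem: "2 * int n - 2 \<in> S" "2 * int n - 2 - 1 \<notin> S" "- 2 * int n + 2 + 1 \<notin> S"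
    using assms(1) by (auto simp: framed_def)
  have notin: "2 * int n - 2 + 1 \<notin> S" "2 * int n \<notin> S" "- 2 * int n - 1 \<notin> S" "- 2 * int n \<notin> S"
    using assms by (auto simp: framed_def)
  have "[2 * int n - 2 - 1..2 * int n + 1] =
      [2 * int n - 2 - 1, 2 * int n - 2, 2 * int n - 2 + 1, 2 * int n, 2 * int n + 1]"
    "[- 2 * int n - 2..- 2 * int n + 2 + 1] =
      [- 2 * int n - 2, - 2 * int n - 1, - 2 * int n, - 2 * int n + 1, - 2 * int n + 2,
       - 2 * int n + 2 + 1]"
    by (simp_all add: upto_rec1)
  note upto = this
  have top: "map (digits (step_odd_mid n S)) (rev [2 * int n - 2 - 1..2 * int n + 1]) = [1, 0, 0, 1, 0]"
    unfolding upto using mem notin assms(2) by (auto simp: digits_def step_odd_mid_def)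
  have bottom: "map (digits (step_odd_mid n S)) (rev [- 2 * int n - 2..- 2 * int n + 2 + 1]) =
      [0, 0, 1, 0, 0, 1]"
    unfolding upto using mem notin assms(2) by (auto simp: digits_def step_odd_mid_def)
  show ?thesis
    unfolding top[symmetric] bottom[symmetric]
    using odd_framed_step_odd_mid[OF assms] assms
    by (intro affix_replacement_digits) (auto simp: odd_framed_def framed_def step_odd_mid_def)
qed

theorem theorem8:
  shows "(\<forall>n k. n \<ge> 1 \<and> 1 \<le> k \<and> k \<le> lucas (2 * n - 1) \<longrightarrow>
           (\<forall>i. gamma (lucas (2 * n) + k) i =
                gamma k i
                + digit_of (1 # replicate (2 * n) 0, replicate (2 * n - 1) 0 @ [1]) i) \<and>
           (\<exists>a b l r. a \<ge> 1 \<and> b \<ge> 1 \<and> word_of (gamma k) = (l, r) \<and>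
                word_of (gamma (lucas (2 * n) + k)) =
                  (1 # replicate a 0 @ l, r @ replicate b 0 @ [1]))) \<and>
         (\<forall>n k. n \<ge> 2 \<and> 1 \<le> k \<and> k \<le> lucas (2 * n - 2) \<longrightarrow>
           affix_replacement [1,0,0,0] [1,0]
             (word_of (gamma (lucas (2 * n - 1) + k))) [0,1] [1,0,0,1]
             (word_of (gamma (lucas (2 * n + 1) + k))) \<and>
           affix_replacement [1,0,1,0] [1,0]
             (word_of (gamma (lucas (2 * n - 1) + k))) [0,1] [0,0,0,1]
             (word_of (gamma (lucas (2 * n + 1) + lucas (2 * n - 1) + k)))) \<and>
         (\<forall>n k. n \<ge> 2 \<and> 1 \<le> k \<and> k \<le> lucas (2 * n - 3) \<longrightarrow>
           affix_replacement [1,0,0,1,0] [1,0]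
             (word_of (gamma (lucas (2 * n - 2) + k))) [0,1] [0,0,1,0,0,1]
             (word_of (gamma (lucas (2 * n + 1) + lucas (2 * n - 2) + k))))"
proof (intro conjI allI impI)
  fix n k :: nat and i
  assume *: "n \<ge> 1 \<and> 1 \<le> k \<and> k \<le> lucas (2 * n - 1)"
  then have "2 * n - 1 = 2 * (n - 1) + 1" by linarith
  with * have n: "1 \<le> n" and k: "1 \<le> k" "k \<le> lucas (2 * (n - 1) + 1)"
    by metis+
  obtain S where S: "canonical k S" "S \<subseteq> {- 2 * int (n - 1)..2 * int (n - 1)}"
    using shapes[of "n - 1"] k unfolding small_shapes_def by blast
  then have range: "S \<subseteq> {- 2 * int n + 2..2 * int n - 2}"
    using n by (simp add: of_nat_diff)
  have gamma: "gamma (lucas (2 * n) + k) = digits (step_even n S)" "gamma k = digits S"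
    using gamma_canonical S(1) canonical_step_even[OF S(1) k(1) n range] by blast+
  \<comment> \<open>The digits add without carry, since neither 2n nor -2n lies in
    \<open>S\<close>.\<close>
  show "gamma (lucas (2 * n) + k) i = gamma k i +
      digit_of (1 # replicate (2 * n) 0, replicate (2 * n - 1) 0 @ [1]) i"
    unfolding gamma digit_of_outer_ones[OF n] using range n
    by (auto simp: digits_def step_even_def)
  show "\<exists>a b l r. a \<ge> 1 \<and> b \<ge> 1 \<and> word_of (gamma k) = (l, r) \<and>
      word_of (gamma (lucas (2 * n) + k)) = (1 # replicate a 0 @ l, r @ replicate b 0 @ [1])"
    unfolding gamma by (rule word_of_step_even[OF S(1) k(1) n range])
next
  fix n k :: nat
  assume *: "n \<ge> 2 \<and> 1 \<le> k \<and> k \<le> lucas (2 * n - 2)"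
  then obtain m where n: "n = Suc (Suc m)"
    by (metis add_2_eq_Suc le_Suc_ex)
  have k: "1 \<le> k" "k \<le> lucas (2 * m + 2)"
    using * by (auto simp: n)
  \<comment> \<open>L(2n-1) + k lies in the range of \<open>odd_shapes (n - 1)\<close>, where n - 1
    \<ge> 1 makes the frame available.\<close>
  have "lucas (2 * Suc m + 1) < lucas (2 * n - 1) + k"
    "lucas (2 * n - 1) + k \<le> lucas (2 * Suc m + 2)" "1 \<le> Suc m"
    using k by (simp_all add: n)
  then obtain S where S: "canonical (lucas (2 * n - 1) + k) S" "odd_framed (Suc m) S"
    using shapes[of m] unfolding odd_shapes_def by blast
  then have framed: "framed (2 * int n - 1) (- 2 * int n) S" "- 2 * int n + 2 \<notin> S"
    by (auto simp: odd_framed_def n algebra_simps)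
  \<comment> \<open>The low step adds L(2n), so both claims start from the support of L(2n-1) +
    k.\<close>
  have luc: "lucas (2 * n + 1) + k = lucas (2 * n) + (lucas (2 * n - 1) + k)"
    by (simp add: n)
  have gamma: "gamma (lucas (2 * n - 1) + k) = digits S"
    "gamma (lucas (2 * n + 1) + k) = digits (step_odd_low n S)"
    "gamma (lucas (2 * n + 1) + lucas (2 * n - 1) + k) = digits (step_odd_high n S)"
    using gamma_canonical[OF S(1)] gamma_canonical[OF canonical_step_odd_low[OF S(1) _ framed]]
      gamma_canonical[OF canonical_step_odd_high[OF S(1) _ framed(1)]]
    unfolding luc by (simp_all add: n add.assoc del: lucas.simps)
  show "affix_replacement [1,0,0,0] [1,0]
      (word_of (gamma (lucas (2 * n - 1) + k))) [0,1] [1,0,0,1]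
      (word_of (gamma (lucas (2 * n + 1) + k)))"
    "affix_replacement [1,0,1,0] [1,0]
      (word_of (gamma (lucas (2 * n - 1) + k))) [0,1] [0,0,0,1]
      (word_of (gamma (lucas (2 * n + 1) + lucas (2 * n - 1) + k)))"
    unfolding gamma using odd_affixes[OF framed(1)] by (simp_all add: n)
next
  fix n k :: nat
  assume *: "n \<ge> 2 \<and> 1 \<le> k \<and> k \<le> lucas (2 * n - 3)"
  then obtain m where n: "n = Suc (Suc m)"
    by (metis add_2_eq_Suc le_Suc_ex)
  have k: "1 \<le> k" "k \<le> lucas (2 * m + 1)"
    using * by (auto simp: n numeral_3_eq_3)
  \<comment> \<open>With m = n - 2, the number L(2n-2) + k lies in the range of
    \<open>even_shape\<close>.\<close>
  obtain S where S: "canonical (lucas (2 * n - 2) + k) S" "framed (2 * int m + 2) (- 2 * int m - 2) S"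
    using even_shape[of m "lucas (2 * n - 2) + k"] shapes[of m] k
    by (auto simp: n numeral_3_eq_3)
  have "2 * int m + 2 = 2 * int n - 2" "- 2 * int m - 2 = - 2 * int n + 2"
    by (simp_all add: n)
  with S(2) have framed: "framed (2 * int n - 2) (- 2 * int n + 2) S" by metis
  have gamma: "gamma (lucas (2 * n - 2) + k) = digits S"
    "gamma (lucas (2 * n + 1) + lucas (2 * n - 2) + k) = digits (step_odd_mid n S)"
    using gamma_canonical[OF S(1)] gamma_canonical[OF canonical_step_odd_mid[OF S(1) _ framed]]
    by (simp_all add: n add.assoc del: lucas.simps)
  show "affix_replacement [1,0,0,1,0] [1,0]
      (word_of (gamma (lucas (2 * n - 2) + k))) [0,1] [0,0,1,0,0,1]
      (word_of (gamma (lucas (2 * n + 1) + lucas (2 * n - 2) + k)))"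
    unfolding gamma using mid_affix[OF framed] by (simp add: n)
qed

end
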